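(* Let $X_i\sim F_i$, $i=1,2,3$, where the distribution functions $F_i$ are strictly increasing and continuous. The standardized rank coskewness $RS(X_1,X_2,X_3)$ satisfies the following properties. (1) $-1\le RS(X_1,X_2,X_3)\le 1$. (2) Let $U,V\sim U[0,1]$ be independent, $I=\mathbf{1}_{U>1/2}$ and $J=\mathbf{1}_{V>1/2}$. The upper bound $1$ is obtained when $X_i=F_i^{-1}(U_i)$, $i=1,2,3$, with $$\begin{aligned}U_1&=U,\\ U_2&=IJU+I(1-J)(1-U)+(1-I)JU+(1-I)(1-J)(1-U),\\ U_3&=IJU+I(1-J)(1-U)+(1-I)J(1-U)+(1-I)(1-J)U.\end{aligned}$$ The lower bound $-1$ is obtained when $X_i=F_i^{-1}(U_i)$, $i=1,2,3$, with $$\begin{aligned}U_1&=U,\\ U_2&=IJU+I(1-J)(1-U)+(1-I)JU+(1-I)(1-J)(1-U),\\ U_3&=IJ(1-U)+I(1-J)U+(1-I)JU+(1-I)(1-J)(1-U).\end{aligned}$$ (3) For arbitrary strictly increasing functions $f_1,f_2,f_3$, $RS(X_1,X_2,X_3)=RS(f_1(X_1),f_2(X_2),f_3(X_3))$. (4) $RS(X_1,X_2,X_3)=0$ if $X_1,X_2,X_3$ are independent.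
   Context: $X\sim F$ means that $X$ has distribution function $F$, and $F^{-1}$ is the quantile function of $F$. For random variables $X_i\sim F_i$, $i=1,2,3$, with $F_i$ strictly increasing and continuous, the standardized rank coskewness is $$RS(X_1,X_2,X_3)=\frac{4\sqrt{3}}{9}S\left(F_1(X_1),F_2(X_2),F_3(X_3)\right)=32\,\mathbb{E}\left(\left(F_1(X_1)-\tfrac12\right)\left(F_2(X_2)-\tfrac12\right)\left(F_3(X_3)-\tfrac12\right)\right),$$ where $S(Y_1,Y_2,Y_3)=\mathbb{E}\left(\prod_{i=1}^3 (Y_i-\mathbb{E}Y_i)\right)/(\sigma_1\sigma_2\sigma_3)$ is the coskewness, $\sigma_i$ being the standard deviation of $Y_i$. $RS(f_1(X_1),f_2(X_2),f_3(X_3))$ is given by the same formula, with $F_i$ replaced by the distribution function of $f_i(X_i)$ and $X_i$ replaced by $f_i(X_i)$. *)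

theory Defs
  imports "HOL-Probability.Probability"
begin

definition has_df :: "'a measure \<Rightarrow> ('a \<Rightarrow> real) \<Rightarrow> (real \<Rightarrow> real) \<Rightarrow> bool" where
  "has_df M X F \<longleftrightarrow> X \<in> borel_measurable M \<and> cdf (distr M borel X) = F"

text \<open>The usual left-continuous generalized inverse. It is only meaningful for \<open>u\<close> strictly
  between 0 and 1; for other \<open>u\<close> the real-valued \<open>Inf\<close> is an unspecified constant, which is
  harmless when \<open>u\<close> is the value of a variable that is uniform on the unit interval.\<close>

definition quantile :: "(real \<Rightarrow> real) \<Rightarrow> real \<Rightarrow> real" where
  "quantile F u = Inf {x. u \<le> F x}"

definition std_dev :: "'a measure \<Rightarrow> ('a \<Rightarrow> real) \<Rightarrow> real" where
  "std_dev M Y = sqrt (prob_space.variance M Y)"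

definition coskewness ::
  "'a measure \<Rightarrow> ('a \<Rightarrow> real) \<Rightarrow> ('a \<Rightarrow> real) \<Rightarrow> ('a \<Rightarrow> real) \<Rightarrow> real" where
  "coskewness M Y1 Y2 Y3 =
     prob_space.expectation M (\<lambda>\<omega>.
         (Y1 \<omega> - prob_space.expectation M Y1)
       * (Y2 \<omega> - prob_space.expectation M Y2)
       * (Y3 \<omega> - prob_space.expectation M Y3))
     / (std_dev M Y1 * std_dev M Y2 * std_dev M Y3)"

text \<open>The rank of a variable is its own distribution function evaluated at it, so
  \<open>rank_coskewness\<close> applied to transformed variables automatically uses the distribution
  functions of the transformed variables. The factor normalizes the range to \<open>[-1, 1]\<close>: a
  uniform variable has mean \<open>1/2\<close> and standard deviation \<open>1 / sqrt 12\<close>, and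
  \<open>4 * sqrt 3 / 9 * (sqrt 12)^3 = 32\<close>, so for continuous distribution functions the value is
  32 times the expectation of the product of the ranks, each centred at \<open>1/2\<close>.\<close>

definition rank_of :: "'a measure \<Rightarrow> ('a \<Rightarrow> real) \<Rightarrow> 'a \<Rightarrow> real" where
  "rank_of M X \<omega> = cdf (distr M borel X) (X \<omega>)"

definition rank_coskewness ::
  "'a measure \<Rightarrow> ('a \<Rightarrow> real) \<Rightarrow> ('a \<Rightarrow> real) \<Rightarrow> ('a \<Rightarrow> real) \<Rightarrow> real" where
  "rank_coskewness M X1 X2 X3 =
     4 * sqrt 3 / 9 * coskewness M (rank_of M X1) (rank_of M X2) (rank_of M X3)"

end

theory Submission
  imports Defs
begin

text \<open>The ranks are uniform on the unit interval, so the rank coskewness is 32 times the mean of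
  the product of the centred ranks. By AM-GM this product is dominated by the average of the three
  absolute cubes, each of mean \<open>1/32\<close>. In the extremal couplings the centred ranks all have the
  same absolute value and the sign of their product is constant, so the bound is attained.
  A strictly increasing transformation leaves the event \<open>X \<le> X \<omega>\<close>, hence the rank, unchanged
  pointwise.\<close>

section \<open>Strictly increasing continuous distribution functions and their quantiles\<close>

locale strict_continuous_df =
  fixes F :: "real \<Rightarrow> real"
  assumes strict: "strict_mono F"
    and cont: "continuous_on UNIV F"
    and lim_bot: "(F \<longlongrightarrow> 0) at_bot"
    and lim_top: "(F \<longlongrightarrow> 1) at_top"
begin

lemma df_pos: "0 < F x"
proof -
  have "eventually (\<lambda>y. F y \<le> F (x - 1)) at_bot"
    using eventually_le_at_bot[of "x - 1"] strict by (auto elim!: eventually_mono simp: strict_mono_less_eq)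
  then have "0 \<le> F (x - 1)"
    by (intro tendsto_upperbound[OF lim_bot]) auto
  also have "\<dots> < F x"
    using strict by (simp add: strict_mono_less)
  finally show ?thesis .
qed

lemma df_less_one: "F x < 1"
proof -
  have "eventually (\<lambda>y. F (x + 1) \<le> F y) at_top"
    using eventually_ge_at_top[of "x + 1"] strict by (auto elim!: eventually_mono simp: strict_mono_less_eq)
  then have "F (x + 1) \<le> 1"
    by (intro tendsto_lowerbound[OF lim_top]) auto
  moreover have "F x < F (x + 1)"
    using strict by (simp add: strict_mono_less)
  ultimately show ?thesis by simp
qed

text \<open>The limits at both ends put \<open>u\<close> strictly between two values of
  \<open>F\<close>, and the intermediate value theorem does the rest.\<close>

lemma df_surj:
  assumes "0 < u" "u < 1"
  obtains x where "F x = u"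
proof -
  obtain a where a: "F a < u"
    using order_tendstoD(2)[OF lim_bot assms(1)] eventually_happens trivial_limit_at_bot_linorder by blast
  obtain b where b: "u < F b"
    using order_tendstoD(1)[OF lim_top assms(2)] eventually_happens trivial_limit_at_top_linorder by blast
  have "a \<le> b"
    using a b strict by (meson less_trans not_le order_less_imp_le strict_mono_less_eq less_le_not_le)
  then obtain x where "F x = u"
    using IVT'[of F a u b] a b continuous_on_subset[OF cont] by auto
  then show ?thesis by (rule that)
qed

lemma quantile_df: "quantile F (F x) = x"
proof -
  have "{y. F x \<le> F y} = {x..}"
    using strict by (auto simp: strict_mono_less_eq)
  then show ?thesis by (simp add: quantile_def)
qed

lemma df_quantile: "0 < u \<Longrightarrow> u < 1 \<Longrightarrow> F (quantile F u) = u"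
  by (metis df_surj quantile_df)

text \<open>This Galois connection is what turns the law of a quantile of a uniform variable into
  the law of the uniform variable itself.\<close>

lemma quantile_le_iff: "0 < u \<Longrightarrow> u < 1 \<Longrightarrow> quantile F u \<le> x \<longleftrightarrow> u \<le> F x"
  by (metis df_quantile strict strict_mono_less_eq)

text \<open>The defining set is everything for \<open>u \<le> 0\<close> and empty for
  \<open>u \<ge> 1\<close>, so \<open>quantile F\<close> is constant on each of these rays. Those
  constants are unspecified, so monotonicity is available only piece by piece.\<close>

lemma measurable_quantile [measurable]: "quantile F \<in> borel_measurable borel"
proof (rule borel_measurable_piecewise_mono[of "{{..0}, {0<..<1}, {1..}}"])
  fix C :: "real set" assume "C \<in> {{..0}, {0<..<1}, {1..}}"
  moreover have "quantile F u = Inf UNIV" if "u \<le> 0" for u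
    using df_pos that by (auto simp: quantile_def intro!: arg_cong[where f=Inf] intro: less_imp_le order_trans)
  moreover have "quantile F u = Inf {}" if "u \<ge> 1" for u
    using less_le_trans[OF df_less_one that] by (auto simp: quantile_def intro!: arg_cong[where f=Inf] dest: leD)
  moreover have "mono_on {0<..<1} (quantile F)"
    by (rule mono_onI) (simp add: quantile_le_iff df_quantile)
  ultimately show "mono_on C (quantile F)"
    by (auto simp: mono_on_def)
qed auto

end

text \<open>General facts on uniform laws divide the density by the length of the interval; for the
  unit interval that length is 1.\<close>

lemma uniform_density_eq:
  "(\<lambda>x. ennreal (indicator {0..1} x / measure lborel {0..1::real})) = indicator {0..1}"
  by (auto simp: indicator_def)

section \<open>Ranks, and moments of uniform variables\<close>

context prob_space
begin

lemma has_df_iff: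
  "has_df M X F \<longleftrightarrow> X \<in> borel_measurable M \<and> F = (\<lambda>x. \<P>(\<omega> in M. X \<omega> \<le> x))"
proof (cases "X \<in> borel_measurable M")
  case True
  then have "cdf (distr M borel X) = (\<lambda>x. \<P>(\<omega> in M. X \<omega> \<le> x))"
    by (auto simp: cdf_def measure_distr fun_eq_iff intro!: arg_cong[where f=prob])
  then show ?thesis
    using True by (auto simp: has_df_def)
qed (simp add: has_df_def)

lemma rank_of_eq:
  assumes "X \<in> borel_measurable M"
  shows "rank_of M X \<omega> = \<P>(\<eta> in M. X \<eta> \<le> X \<omega>)"
  using has_df_iff[of X "cdf (distr M borel X)"] assms
  by (auto simp: rank_of_def has_df_def fun_eq_iff)

lemma rank_of_strict_mono:
  assumes "X \<in> borel_measurable M" "strict_mono (f :: real \<Rightarrow> real)"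
  shows "rank_of M (\<lambda>\<omega>. f (X \<omega>)) = rank_of M X"
proof
  fix \<omega>
  \<comment> \<open>Monotonicity alone makes \<open>f\<close> Borel, so jumps of \<open>f\<close>
    are allowed.\<close>
  have [measurable]: "f \<in> borel_measurable borel"
    using assms(2) by (intro borel_measurable_mono strict_mono_mono)
  show "rank_of M (\<lambda>\<omega>. f (X \<omega>)) \<omega> = rank_of M X \<omega>"
    using assms by (simp add: rank_of_eq strict_mono_less_eq)
qed

lemma uniform_iff:
  "distributed M lborel Y (indicator {0..1}) \<longleftrightarrow>
     Y \<in> borel_measurable M \<and> (\<forall>t\<in>{0..1}. \<P>(\<omega> in M. Y \<omega> \<le> t) = t)"
  using uniform_distributed_iff[of Y 0 1] unfolding uniform_density_eq by simp

text \<open>The two endpoints are null sets. Discarding them keeps the argument of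
  \<open>quantile\<close> in the range where it inverts \<open>F\<close>.\<close>

lemma uniform_AE:
  assumes "distributed M lborel Y (indicator {0..1::real})"
  shows "AE \<omega> in M. 0 < Y \<omega> \<and> Y \<omega> < 1"
proof -
  have "AE x in lborel. (0::ennreal) < indicator {0..1} x \<longrightarrow> 0 < x \<and> x < (1::real)"
    using AE_lborel_singleton[of 0] AE_lborel_singleton[of 1]
    by eventually_elim (auto simp: indicator_def)
  then show ?thesis
    using distributed_AE2[OF assms, of "\<lambda>x. 0 < x \<and> x < 1"] by simp
qed

lemma uniform_expectation:
  assumes "distributed M lborel Y (indicator {0..1::real})"
  shows "expectation Y = 1 / 2"
  using uniform_distributed_expectation[of Y 0 1] assms unfolding uniform_density_eq by simp

lemma uniform_variance:
  assumes "distributed M lborel Y (indicator {0..1::real})"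
  shows "variance Y = 1 / 12"
  using uniform_distributed_variance[of Y 0 1] assms unfolding uniform_density_eq by simp

lemma uniform_third_absolute_moment:
  assumes "distributed M lborel Y (indicator {0..1::real})"
  shows "integrable M (\<lambda>\<omega>. \<bar>Y \<omega> - 1/2\<bar> ^ 3)"
    and "expectation (\<lambda>\<omega>. \<bar>Y \<omega> - 1/2\<bar> ^ 3) = 1 / 32"
proof -
  \<comment> \<open>The transfer of integrals along \<open>Y\<close> expects the density as a
    coerced real function.\<close>
  have D: "distributed M lborel Y (\<lambda>x. ennreal (indicator {0..1} x))"
    using assms by (simp add: ennreal_indicator)
  \<comment> \<open>The antiderivative is \<open>(x - 1/2)^4 / 4\<close>; each half of the unit
    interval contributes 1/64 in absolute value, whence 1/32.\<close>
  have h: "has_bochner_integral lborel (\<lambda>x. (x - 1/2)^3 * indicator {a..b} x)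
      ((b - 1/2)^4 / 4 - (a - 1/2)^4 / 4)" if "a \<le> b" for a b :: real
    using that
    by (intro has_bochner_integral_FTC_Icc_real)
       (auto intro!: derivative_eq_intros continuous_intros simp: field_simps)
  have "has_bochner_integral lborel (\<lambda>x::real. (x - 1/2)^3 * indicator {1/2..1} x
      - (x - 1/2)^3 * indicator {0..1/2} x) (1 / 32)"
    using has_bochner_integral_diff[OF h[of "1/2" 1] h[of 0 "1/2"]]
    by (simp add: power4_eq_xxxx)
  also have "(\<lambda>x::real. (x - 1/2)^3 * indicator {1/2..1} x - (x - 1/2)^3 * indicator {0..1/2} x)
      = (\<lambda>x. indicator {0..1} x * \<bar>x - 1/2\<bar>^3)"
  proof
    fix x :: real
    show "(x - 1/2)^3 * indicator {1/2..1} x - (x - 1/2)^3 * indicator {0..1/2} x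
      = indicator {0..1} x * \<bar>x - 1/2\<bar>^3"
    \<comment> \<open>The midpoint lies in both half intervals, but the cubes vanish there.\<close>
    proof (cases "x = 1/2")
      case False
      then show ?thesis
        by (auto simp: indicator_def abs_if power3_eq_cube algebra_simps)
    qed simp
  qed
  finally have *: "has_bochner_integral lborel (\<lambda>x::real. indicator {0..1} x * \<bar>x - 1/2\<bar>^3) (1/32)" .
  show "expectation (\<lambda>\<omega>. \<bar>Y \<omega> - 1/2\<bar> ^ 3) = 1 / 32"
    using distributed_integral[OF D, of "\<lambda>x. \<bar>x - 1/2\<bar>^3"] has_bochner_integral_integral_eq[OF *]
    by simp
  show "integrable M (\<lambda>\<omega>. \<bar>Y \<omega> - 1/2\<bar> ^ 3)"
    using distributed_integrable[OF D, of "\<lambda>x. \<bar>x - 1/2\<bar>^3"] has_bochner_integral_iff[THEN iffD1, OF *]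
    by simp
qed

lemma rank_coskewness_uniform_ranks:
  assumes "distributed M lborel (rank_of M X1) (indicator {0..1})"
    and "distributed M lborel (rank_of M X2) (indicator {0..1})"
    and "distributed M lborel (rank_of M X3) (indicator {0..1})"
  shows "rank_coskewness M X1 X2 X3 = 32 * expectation (\<lambda>\<omega>.
    (rank_of M X1 \<omega> - 1/2) * (rank_of M X2 \<omega> - 1/2) * (rank_of M X3 \<omega> - 1/2))"
proof -
  have "4 * sqrt 3 / 9 * (a / (sqrt (1/12) * sqrt (1/12) * sqrt (1/12))) = 32 * a" for a
  proof -
    \<comment> \<open>With this, \<open>(sqrt 12)^3\<close> is \<open>24 * sqrt 3\<close>, and the
      remaining roots multiply to 3.\<close>
    have "sqrt 12 = 2 * sqrt (3::real)"
      using real_sqrt_mult[of 4 3] by simp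
    then show ?thesis
      by (simp add: real_sqrt_divide field_simps)
  qed
  then show ?thesis
    \<comment> \<open>The variance mentions the mean, so the variance facts get 1/2 in its place in
      order to match the rewritten goal.\<close>
    unfolding rank_coskewness_def coskewness_def std_dev_def
      assms[THEN uniform_variance, unfolded assms[THEN uniform_expectation]]
      assms[THEN uniform_expectation] .
qed

section \<open>Probability integral transform and quantile transform\<close>

text \<open>Reduces the hypotheses on a variable to properties of \<open>F\<close> alone, which can
  then be used on the different probability space carrying the extremal couplings.\<close>

lemma has_df_strict_continuous_df:
  assumes "has_df M X F" "strict_mono F" "continuous_on UNIV F"
  shows "strict_continuous_df F"
proof -
  have "X \<in> borel_measurable M" and F: "F = cdf (distr M borel X)"
    using assms(1) by (auto simp: has_df_def)
  then interpret D: real_distribution "distr M borel X"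
    by (intro real_distribution_distr)
  show ?thesis
    using assms D.cdf_lim_at_bot D.cdf_lim_at_top_prob
    by (simp add: strict_continuous_df_def F)
qed

text \<open>By continuity every level \<open>t\<close> inside the unit interval is some
  \<open>F x\<close>, and by strictness \<open>F (X \<omega>) \<le> F x\<close> is the event
  \<open>X \<omega> \<le> x\<close>, of probability \<open>F x\<close>.\<close>

lemma rank_of_uniform:
  assumes "has_df M X F" "strict_mono F" "continuous_on UNIV F"
  shows "distributed M lborel (rank_of M X) (indicator {0..1})"
proof -
  interpret strict_continuous_df F
    using assms by (rule has_df_strict_continuous_df)
  have X[measurable]: "X \<in> borel_measurable M" and F: "F = (\<lambda>x. \<P>(\<omega> in M. X \<omega> \<le> x))"
    using assms(1) by (auto simp: has_df_iff)
  have R: "rank_of M X = (\<lambda>\<omega>. F (X \<omega>))"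
    by (simp add: fun_eq_iff rank_of_eq F)
  have [measurable]: "F \<in> borel_measurable borel"
    by (intro borel_measurable_continuous_onI cont)
  have "\<P>(\<omega> in M. F (X \<omega>) \<le> t) = t" if t: "0 \<le> t" "t \<le> 1" for t
  proof -
    \<comment> \<open>The levels 0 and 1 are not values of \<open>F\<close>; there the event is
      empty or the whole space.\<close>
    consider "t = 0" | "t = 1" | "0 < t" "t < 1" using t by fastforce
    then show ?thesis
    proof cases
      case 1
      moreover have "\<not> F x \<le> 0" for x
        using df_pos[of x] by simp
      ultimately show ?thesis by simp
    next
      case 2
      then show ?thesis using df_less_one by (simp add: less_imp_le prob_space)
    next
      case 3
      then obtain x where x: "F x = t" by (rule df_surj)
      have "\<P>(\<omega> in M. F (X \<omega>) \<le> t) = \<P>(\<omega> in M. X \<omega> \<le> x)"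
        using strict by (simp add: x[symmetric] strict_mono_less_eq)
      also have "\<dots> = F x" by (simp add: F)
      finally show ?thesis using x by simp
    qed
  qed
  then show ?thesis
    by (auto simp: uniform_iff R)
qed

text \<open>Converse of the probability integral transform. Once the law is known to be
  \<open>F\<close>, the rank is \<open>F (quantile F (W \<omega>))\<close>, which is
  \<open>W \<omega>\<close> except possibly where \<open>W\<close> leaves the open unit
  interval.\<close>

lemma quantile_uniform:
  assumes "strict_continuous_df F" "distributed M lborel W (indicator {0..1})"
  shows has_df_quantile_uniform: "has_df M (\<lambda>\<omega>. quantile F (W \<omega>)) F"
    and rank_of_quantile_uniform: "AE \<omega> in M. rank_of M (\<lambda>\<omega>. quantile F (W \<omega>)) \<omega> = W \<omega>"
proof -
  interpret strict_continuous_df F by fact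
  have [measurable]: "W \<in> borel_measurable M"
    and W: "\<And>t. 0 \<le> t \<Longrightarrow> t \<le> 1 \<Longrightarrow> \<P>(\<omega> in M. W \<omega> \<le> t) = t"
    using assms(2) by (auto simp: uniform_iff)
  have "\<P>(\<omega> in M. quantile F (W \<omega>) \<le> x) = F x" for x
  proof -
    have "\<P>(\<omega> in M. quantile F (W \<omega>) \<le> x) = \<P>(\<omega> in M. W \<omega> \<le> F x)"
      using uniform_AE[OF assms(2)]
      by (intro finite_measure_eq_AE) (auto elim!: eventually_mono simp: quantile_le_iff simp del: AE_conj_iff)
    then show ?thesis
      using W[of "F x"] df_pos[of x] df_less_one[of x] by simp
  qed
  then show *: "has_df M (\<lambda>\<omega>. quantile F (W \<omega>)) F"
    by (simp add: has_df_iff)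
  then show "AE \<omega> in M. rank_of M (\<lambda>\<omega>. quantile F (W \<omega>)) \<omega> = W \<omega>"
    using uniform_AE[OF assms(2)]
    by (auto simp: rank_of_def has_df_def df_quantile elim!: eventually_mono simp del: AE_conj_iff)
qed

section \<open>Uniformity of randomly reflected variables\<close>

text \<open>A reflection decided by an independent fair coin: \<open>g u\<close> and \<open>1 - g u\<close> are
  \<open>u\<close> and \<open>1 - u\<close> in one of the two orders, so averaging over the coin removes \<open>g\<close>.\<close>

lemma uniform_reflection:
  fixes U V :: "'a \<Rightarrow> real" and g :: "real \<Rightarrow> real"
  assumes U: "distributed M lborel U (indicator {0..1})"
    and V: "distributed M lborel V (indicator {0..1})"
    and indep: "indep_var borel U borel V"
    and [measurable]: "g \<in> borel_measurable borel"
    and g: "\<And>u. g u = u \<or> g u = 1 - u"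
  shows "distributed M lborel (\<lambda>\<omega>. if V \<omega> > 1/2 then g (U \<omega>) else 1 - g (U \<omega>)) (indicator {0..1})"
proof -
  have [measurable]: "U \<in> borel_measurable M" "V \<in> borel_measurable M"
    and Ut: "\<And>t. 0 \<le> t \<Longrightarrow> t \<le> 1 \<Longrightarrow> \<P>(\<omega> in M. U \<omega> \<le> t) = t"
    and Vt: "\<And>t. 0 \<le> t \<Longrightarrow> t \<le> 1 \<Longrightarrow> \<P>(\<omega> in M. V \<omega> \<le> t) = t"
    using U V by (auto simp: uniform_iff)
  \<comment> \<open>The coin is fair. Both sides are written as membership in a set, the form taken
    by the product rule for independent variables.\<close>
  have V1: "\<P>(\<omega> in M. V \<omega> \<in> {..1/2}) = 1/2"
    using Vt[of "1/2"] by simp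
  have V2: "\<P>(\<omega> in M. V \<omega> \<in> {1/2<..}) = 1/2"
    using prob_neg[of "\<lambda>\<omega>. V \<omega> \<le> 1/2"] Vt[of "1/2"] by (simp add: not_le)
  have sym: "\<P>(\<omega> in M. 1 - U \<omega> \<le> t) = \<P>(\<omega> in M. U \<omega> \<le> t)" if "0 \<le> t" "t \<le> 1" for t :: real
  proof -
    \<comment> \<open>The reflected event is \<open>U \<omega> \<ge> 1 - t\<close>; since the
      boundary is null, it agrees almost surely with the complement of
      \<open>U \<omega> \<le> 1 - t\<close>.\<close>
    have "AE \<omega> in M. U \<omega> \<noteq> 1 - t"
      using AE_lborel_singleton[of "1 - t"]
      by (subst distributed_AE2[OF U, of "\<lambda>x. x \<noteq> 1 - t"]) (auto elim!: eventually_mono)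
    then have "\<P>(\<omega> in M. 1 - U \<omega> \<le> t) = \<P>(\<omega> in M. \<not> U \<omega> \<le> 1 - t)"
      by (intro finite_measure_eq_AE) (auto elim!: eventually_mono)
    then show ?thesis
      using prob_neg[of "\<lambda>\<omega>. U \<omega> \<le> 1 - t"] Ut[of t] Ut[of "1 - t"] that by simp
  qed
  have "\<P>(\<omega> in M. (if V \<omega> > 1/2 then g (U \<omega>) else 1 - g (U \<omega>)) \<le> t) = t" (is "?P = _")
    if t: "0 \<le> t" "t \<le> 1" for t :: real
  proof -
    let ?A = "{u. g u \<le> t}" and ?B = "{u. 1 - g u \<le> t}"
    have split: "prob {\<omega> \<in> space M. Q \<omega>} = \<P>(\<omega> in M. R \<omega> \<and> Q \<omega>) + \<P>(\<omega> in M. \<not> R \<omega> \<and> Q \<omega>)"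
      if [measurable]: "Measurable.pred M Q" "Measurable.pred M R" for Q R
      by (subst finite_measure_Union[symmetric]) (auto intro!: arg_cong[where f=prob])
    \<comment> \<open>On the event that \<open>g\<close> fixes the value of \<open>U\<close> it acts
      as the identity, off it as the reflection.\<close>
    have gU: "(g (U \<omega>) = U \<omega> \<and> g (U \<omega>) \<le> t) = (g (U \<omega>) = U \<omega> \<and> U \<omega> \<le> t)"
      "(g (U \<omega>) \<noteq> U \<omega> \<and> g (U \<omega>) \<le> t) = (g (U \<omega>) \<noteq> U \<omega> \<and> 1 - U \<omega> \<le> t)"
      "(g (U \<omega>) = U \<omega> \<and> 1 - g (U \<omega>) \<le> t) = (g (U \<omega>) = U \<omega> \<and> 1 - U \<omega> \<le> t)"
      "(g (U \<omega>) \<noteq> U \<omega> \<and> 1 - g (U \<omega>) \<le> t) = (g (U \<omega>) \<noteq> U \<omega> \<and> U \<omega> \<le> t)" for \<omega>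
      using g[of "U \<omega>"] by auto
    have AB: "?A \<in> sets borel" "?B \<in> sets borel"
      by measurable
    have "?P = \<P>(\<omega> in M. 1/2 < V \<omega> \<and> (if V \<omega> > 1/2 then g (U \<omega>) else 1 - g (U \<omega>)) \<le> t)
        + \<P>(\<omega> in M. \<not> 1/2 < V \<omega> \<and> (if V \<omega> > 1/2 then g (U \<omega>) else 1 - g (U \<omega>)) \<le> t)"
      by (rule split) measurable
    also have "\<dots> = \<P>(\<omega> in M. U \<omega> \<in> ?A \<and> V \<omega> \<in> {1/2<..}) + \<P>(\<omega> in M. U \<omega> \<in> ?B \<and> V \<omega> \<in> {..1/2})"
      by (intro arg_cong2[where f="(+)"] arg_cong[where f=prob]) auto
    also have "\<dots> = (\<P>(\<omega> in M. g (U \<omega>) \<le> t) + \<P>(\<omega> in M. 1 - g (U \<omega>) \<le> t)) / 2"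
      by (simp only: V1 V2 prob_indep_random_variable[OF indep AB(1) greaterThan_borel]
          prob_indep_random_variable[OF indep AB(2) atMost_borel]) simp
    \<comment> \<open>Split all four probabilities along the event that \<open>g\<close> fixes the
      value of \<open>U\<close>: both sums consist of the same four pieces, paired
      differently.\<close>
    also have "\<dots> = (\<P>(\<omega> in M. U \<omega> \<le> t) + \<P>(\<omega> in M. 1 - U \<omega> \<le> t)) / 2"
      using split[of "\<lambda>\<omega>. g (U \<omega>) \<le> t" "\<lambda>\<omega>. g (U \<omega>) = U \<omega>"]
        split[of "\<lambda>\<omega>. 1 - g (U \<omega>) \<le> t" "\<lambda>\<omega>. g (U \<omega>) = U \<omega>"]
        split[of "\<lambda>\<omega>. U \<omega> \<le> t" "\<lambda>\<omega>. g (U \<omega>) = U \<omega>"]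
        split[of "\<lambda>\<omega>. 1 - U \<omega> \<le> t" "\<lambda>\<omega>. g (U \<omega>) = U \<omega>"]
      by (simp add: gU)
    also have "\<dots> = t"
      using Ut sym t by simp
    finally show ?thesis .
  qed
  then show ?thesis
    by (auto simp: uniform_iff)
qed

section \<open>The sharp bound on the product moment\<close>

lemma uniform_triple_product_bound:
  assumes "distributed M lborel Y1 (indicator {0..1::real})"
    and "distributed M lborel Y2 (indicator {0..1::real})"
    and "distributed M lborel Y3 (indicator {0..1::real})"
  shows "\<bar>expectation (\<lambda>\<omega>. (Y1 \<omega> - 1/2) * (Y2 \<omega> - 1/2) * (Y3 \<omega> - 1/2))\<bar> \<le> 1 / 32"
proof -
  note int = assms[THEN uniform_third_absolute_moment(1)]
  note mom = assms[THEN uniform_third_absolute_moment(2)]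
  let ?P = "\<lambda>\<omega>. (Y1 \<omega> - 1/2) * (Y2 \<omega> - 1/2) * (Y3 \<omega> - 1/2)"
  let ?S = "\<lambda>\<omega>. (\<bar>Y1 \<omega> - 1/2\<bar>^3 + \<bar>Y2 \<omega> - 1/2\<bar>^3 + \<bar>Y3 \<omega> - 1/2\<bar>^3) / 3"
  have [measurable]: "Y1 \<in> borel_measurable M" "Y2 \<in> borel_measurable M" "Y3 \<in> borel_measurable M"
    using assms by (auto simp: uniform_iff)
  have amgm: "a * b * c \<le> (a^3 + b^3 + c^3) / 3" if "0 \<le> a" "0 \<le> b" "0 \<le> c" for a b c :: real
  proof -
    \<comment> \<open>The classical factorization, whose second factor is a sum of squares, gives
      AM-GM for three cubes.\<close>
    have "a^3 + b^3 + c^3 - 3 * (a * b * c) = (a + b + c) * ((a - b)^2 + (b - c)^2 + (c - a)^2) / 2"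
      by algebra
    also have "\<dots> \<ge> 0" using that by simp
    finally show ?thesis by simp
  qed
  have le: "\<bar>?P \<omega>\<bar> \<le> ?S \<omega>" for \<omega>
    unfolding abs_mult by (rule amgm) auto
  have intS: "integrable M ?S"
    using int by auto
  then have "integrable M ?P"
    \<comment> \<open>The AM-GM majorant also supplies integrability of the product.\<close>
    by (rule Bochner_Integration.integrable_bound) (use le in \<open>auto intro: order_trans\<close>)
  then have "\<bar>expectation ?P\<bar> \<le> expectation ?S"
    by (intro order_trans[OF integral_abs_bound] integral_mono intS le) auto
  also have "\<dots> = 1 / 32"
    using int by (simp add: mom)
  finally show ?thesis .
qed

text \<open>Handles both extremes at once: \<open>c\<close> is the constant sign of the product, and
  the factor 32 cancels the third absolute moment 1/32.\<close>

lemma rank_coskewness_quantile_extremal: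
  assumes F: "strict_continuous_df F1" "strict_continuous_df F2" "strict_continuous_df F3"
    and W1: "distributed M lborel W1 (indicator {0..1})"
    and W2: "distributed M lborel W2 (indicator {0..1})"
    and W3: "distributed M lborel W3 (indicator {0..1})"
    and prod: "\<And>\<omega>. (W1 \<omega> - 1/2) * (W2 \<omega> - 1/2) * (W3 \<omega> - 1/2) = c * \<bar>W1 \<omega> - 1/2\<bar>^3"
  shows "rank_coskewness M (\<lambda>\<omega>. quantile F1 (W1 \<omega>)) (\<lambda>\<omega>. quantile F2 (W2 \<omega>))
    (\<lambda>\<omega>. quantile F3 (W3 \<omega>)) = c"
proof -
  have uniform: "distributed M lborel (rank_of M (\<lambda>\<omega>. quantile G (W \<omega>))) (indicator {0..1})"
    if "strict_continuous_df G" "distributed M lborel W (indicator {0..1})" for G W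
    using has_df_quantile_uniform[OF that] that(1)
    by (intro rank_of_uniform) (auto simp: strict_continuous_df_def)
  have [measurable]: "rank_of M (\<lambda>\<omega>. quantile F1 (W1 \<omega>)) \<in> borel_measurable M"
    "rank_of M (\<lambda>\<omega>. quantile F2 (W2 \<omega>)) \<in> borel_measurable M"
    "rank_of M (\<lambda>\<omega>. quantile F3 (W3 \<omega>)) \<in> borel_measurable M" "W1 \<in> borel_measurable M"
    "W2 \<in> borel_measurable M" "W3 \<in> borel_measurable M"
    using uniform[OF F(1) W1] uniform[OF F(2) W2] uniform[OF F(3) W3] W1 W2 W3 by (auto simp: uniform_iff)
  \<comment> \<open>The ranks recover \<open>W1\<close>, \<open>W2\<close>, \<open>W3\<close> only
    almost surely, which is enough under the integral.\<close>
  have "expectation (\<lambda>\<omega>. (rank_of M (\<lambda>\<omega>. quantile F1 (W1 \<omega>)) \<omega> - 1/2)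
      * (rank_of M (\<lambda>\<omega>. quantile F2 (W2 \<omega>)) \<omega> - 1/2)
      * (rank_of M (\<lambda>\<omega>. quantile F3 (W3 \<omega>)) \<omega> - 1/2)) = expectation (\<lambda>\<omega>. c * \<bar>W1 \<omega> - 1/2\<bar>^3)"
    using rank_of_quantile_uniform[OF F(1) W1] rank_of_quantile_uniform[OF F(2) W2]
      rank_of_quantile_uniform[OF F(3) W3]
    by (intro integral_cong_AE) (auto simp: prod[symmetric])
  also have "\<dots> = c / 32"
    by (simp add: uniform_third_absolute_moment[OF W1])
  finally show ?thesis
    by (simp add: rank_coskewness_uniform_ranks uniform F W1 W2 W3)
qed

end

section \<open>Bounds, extremal couplings, invariance and independence\<close>

theorem proposition4p3:
  fixes M :: "'a measure"
    and X :: "nat \<Rightarrow> 'a \<Rightarrow> real"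
    and F :: "nat \<Rightarrow> real \<Rightarrow> real"
  assumes "prob_space M"
    and "\<And>i. i \<in> {1,2,3} \<Longrightarrow> has_df M (X i) (F i)"
    and "\<And>i. i \<in> {1,2,3} \<Longrightarrow> strict_mono (F i)"
    and "\<And>i. i \<in> {1,2,3} \<Longrightarrow> continuous_on UNIV (F i)"
  shows
    "(-1 \<le> rank_coskewness M (X 1) (X 2) (X 3) \<and> rank_coskewness M (X 1) (X 2) (X 3) \<le> 1)
   \<and> (\<forall>(N :: 'b measure) (U :: 'b \<Rightarrow> real) (V :: 'b \<Rightarrow> real).
        prob_space N
        \<and> distributed N lborel U (indicator {0..1})
        \<and> distributed N lborel V (indicator {0..1})
        \<and> prob_space.indep_var N borel U borel V \<longrightarrow>
        (let I = (indicator {\<omega>. U \<omega> > 1/2} :: 'b \<Rightarrow> real);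
             J = (indicator {\<omega>. V \<omega> > 1/2} :: 'b \<Rightarrow> real);
             U1 = U;
             U2 = (\<lambda>\<omega>. I \<omega> * J \<omega> * U \<omega> + I \<omega> * (1 - J \<omega>) * (1 - U \<omega>)
                      + (1 - I \<omega>) * J \<omega> * U \<omega> + (1 - I \<omega>) * (1 - J \<omega>) * (1 - U \<omega>));
             U3 = (\<lambda>\<omega>. I \<omega> * J \<omega> * U \<omega> + I \<omega> * (1 - J \<omega>) * (1 - U \<omega>)
                      + (1 - I \<omega>) * J \<omega> * (1 - U \<omega>) + (1 - I \<omega>) * (1 - J \<omega>) * U \<omega>);
             X1 = (\<lambda>\<omega>. quantile (F 1) (U1 \<omega>));
             X2 = (\<lambda>\<omega>. quantile (F 2) (U2 \<omega>));
             X3 = (\<lambda>\<omega>. quantile (F 3) (U3 \<omega>))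
         in has_df N X1 (F 1) \<and> has_df N X2 (F 2) \<and> has_df N X3 (F 3)
            \<and> rank_coskewness N X1 X2 X3 = 1)
        \<and>
        (let I = (indicator {\<omega>. U \<omega> > 1/2} :: 'b \<Rightarrow> real);
             J = (indicator {\<omega>. V \<omega> > 1/2} :: 'b \<Rightarrow> real);
             U1 = U;
             U2 = (\<lambda>\<omega>. I \<omega> * J \<omega> * U \<omega> + I \<omega> * (1 - J \<omega>) * (1 - U \<omega>)
                      + (1 - I \<omega>) * J \<omega> * U \<omega> + (1 - I \<omega>) * (1 - J \<omega>) * (1 - U \<omega>));
             U3 = (\<lambda>\<omega>. I \<omega> * J \<omega> * (1 - U \<omega>) + I \<omega> * (1 - J \<omega>) * U \<omega>
                      + (1 - I \<omega>) * J \<omega> * U \<omega> + (1 - I \<omega>) * (1 - J \<omega>) * (1 - U \<omega>));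
             X1 = (\<lambda>\<omega>. quantile (F 1) (U1 \<omega>));
             X2 = (\<lambda>\<omega>. quantile (F 2) (U2 \<omega>));
             X3 = (\<lambda>\<omega>. quantile (F 3) (U3 \<omega>))
         in has_df N X1 (F 1) \<and> has_df N X2 (F 2) \<and> has_df N X3 (F 3)
            \<and> rank_coskewness N X1 X2 X3 = -1))
   \<and> (\<forall>f :: nat \<Rightarrow> real \<Rightarrow> real.
        (\<forall>i\<in>{1,2,3}. strict_mono (f i)) \<longrightarrow>
        rank_coskewness M (X 1) (X 2) (X 3)
        = rank_coskewness M (\<lambda>\<omega>. f 1 (X 1 \<omega>)) (\<lambda>\<omega>. f 2 (X 2 \<omega>)) (\<lambda>\<omega>. f 3 (X 3 \<omega>)))
   \<and> (prob_space.indep_vars M (\<lambda>_. borel) X {1,2,3} \<longrightarrow>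
        rank_coskewness M (X 1) (X 2) (X 3) = 0)"
proof -
  interpret prob_space M by fact
  note df = assms(2) and mono = assms(3) and cont = assms(4)
  have R: "distributed M lborel (rank_of M (X i)) (indicator {0..1})" if "i \<in> {1,2,3}" for i
    using df mono cont that by (intro rank_of_uniform)
  have F: "strict_continuous_df (F i)" if "i \<in> {1,2,3}" for i
    using df mono cont that by (intro has_df_strict_continuous_df)
  have X: "X i \<in> borel_measurable M" if "i \<in> {1,2,3}" for i
    using df[OF that] by (simp add: has_df_def)
  let ?E = "\<lambda>\<omega>. (rank_of M (X 1) \<omega> - 1/2) * (rank_of M (X 2) \<omega> - 1/2) * (rank_of M (X 3) \<omega> - 1/2)"
  have RS: "rank_coskewness M (X 1) (X 2) (X 3) = 32 * expectation ?E"
    by (intro rank_coskewness_uniform_ranks R) auto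

  have bounds: "-1 \<le> rank_coskewness M (X 1) (X 2) (X 3) \<and> rank_coskewness M (X 1) (X 2) (X 3) \<le> 1"
    unfolding RS using uniform_triple_product_bound[OF R[of 1] R[of 2] R[of 3]]
    by (auto simp: abs_le_iff)

  have invariance: "rank_coskewness M (X 1) (X 2) (X 3)
      = rank_coskewness M (\<lambda>\<omega>. f 1 (X 1 \<omega>)) (\<lambda>\<omega>. f 2 (X 2 \<omega>)) (\<lambda>\<omega>. f 3 (X 3 \<omega>))"
    if "\<forall>i\<in>{1,2,3}. strict_mono (f i)" for f :: "nat \<Rightarrow> real \<Rightarrow> real"
    using that X by (simp add: rank_coskewness_def rank_of_strict_mono)

  have independent: "rank_coskewness M (X 1) (X 2) (X 3) = 0" if "indep_vars (\<lambda>_. borel) X {1,2,3}"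
  proof -
    \<comment> \<open>Each centred rank is a Borel function of its own variable, so independence is
      inherited.\<close>
    have "indep_vars (\<lambda>_. borel) (\<lambda>i \<omega>. F i (X i \<omega>) - 1/2) {1,2,3}"
      using cont by (intro indep_vars_compose2[OF that, where Y="\<lambda>i x. F i x - 1/2"])
        (auto intro!: borel_measurable_continuous_onI continuous_intros)
    moreover have "(\<lambda>\<omega>. F i (X i \<omega>)) = rank_of M (X i)" if "i \<in> {1,2,3}" for i
      using df[OF that] by (auto simp: has_df_def rank_of_def)
    then have rank: "F i (X i \<omega>) = rank_of M (X i) \<omega>" if "i \<in> {1,2,3}" for i \<omega>
      using that by metis
    ultimately have indep: "indep_vars (\<lambda>_. borel) (\<lambda>i \<omega>. rank_of M (X i) \<omega> - 1/2) {1,2,3}"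
      by (subst indep_vars_cong[OF refl _ refl]) (auto simp: rank[symmetric])
    \<comment> \<open>Ranks lie between 0 and 1 almost surely, so the expectation of the product
      factorizes; every factor then vanishes because the mean rank is 1/2.\<close>
    have int: "integrable M (rank_of M (X i))" if "i \<in> {1,2,3}" for i
      using R[OF that] uniform_AE[OF R[OF that]]
      by (intro integrable_const_bound[where B=1]) (auto simp: uniform_iff simp del: AE_conj_iff elim!: eventually_mono)
    have "expectation (\<lambda>\<omega>. \<Prod>i\<in>{1,2,3}. rank_of M (X i) \<omega> - 1/2)
        = (\<Prod>i\<in>{1,2,3}. expectation (\<lambda>\<omega>. rank_of M (X i) \<omega> - 1/2))"
      using int by (intro indep_vars_lebesgue_integral indep) auto
    also have "\<dots> = 0"
      using int uniform_expectation[OF R] by (simp add: prob_space)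
    finally show ?thesis
      unfolding RS by (simp add: mult.assoc)
  qed

  have extremal: "(let I = (indicator {\<omega>. U \<omega> > 1/2} :: 'b \<Rightarrow> real);
             J = (indicator {\<omega>. V \<omega> > 1/2} :: 'b \<Rightarrow> real);
             U1 = U;
             U2 = (\<lambda>\<omega>. I \<omega> * J \<omega> * U \<omega> + I \<omega> * (1 - J \<omega>) * (1 - U \<omega>)
                      + (1 - I \<omega>) * J \<omega> * U \<omega> + (1 - I \<omega>) * (1 - J \<omega>) * (1 - U \<omega>));
             U3 = (\<lambda>\<omega>. I \<omega> * J \<omega> * U \<omega> + I \<omega> * (1 - J \<omega>) * (1 - U \<omega>)
                      + (1 - I \<omega>) * J \<omega> * (1 - U \<omega>) + (1 - I \<omega>) * (1 - J \<omega>) * U \<omega>);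
             X1 = (\<lambda>\<omega>. quantile (F 1) (U1 \<omega>));
             X2 = (\<lambda>\<omega>. quantile (F 2) (U2 \<omega>));
             X3 = (\<lambda>\<omega>. quantile (F 3) (U3 \<omega>))
         in has_df N X1 (F 1) \<and> has_df N X2 (F 2) \<and> has_df N X3 (F 3)
            \<and> rank_coskewness N X1 X2 X3 = 1)" (is ?upper)
    "(let I = (indicator {\<omega>. U \<omega> > 1/2} :: 'b \<Rightarrow> real);
             J = (indicator {\<omega>. V \<omega> > 1/2} :: 'b \<Rightarrow> real);
             U1 = U;
             U2 = (\<lambda>\<omega>. I \<omega> * J \<omega> * U \<omega> + I \<omega> * (1 - J \<omega>) * (1 - U \<omega>)
                      + (1 - I \<omega>) * J \<omega> * U \<omega> + (1 - I \<omega>) * (1 - J \<omega>) * (1 - U \<omega>));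
             U3 = (\<lambda>\<omega>. I \<omega> * J \<omega> * (1 - U \<omega>) + I \<omega> * (1 - J \<omega>) * U \<omega>
                      + (1 - I \<omega>) * J \<omega> * U \<omega> + (1 - I \<omega>) * (1 - J \<omega>) * (1 - U \<omega>));
             X1 = (\<lambda>\<omega>. quantile (F 1) (U1 \<omega>));
             X2 = (\<lambda>\<omega>. quantile (F 2) (U2 \<omega>));
             X3 = (\<lambda>\<omega>. quantile (F 3) (U3 \<omega>))
         in has_df N X1 (F 1) \<and> has_df N X2 (F 2) \<and> has_df N X3 (F 3)
            \<and> rank_coskewness N X1 X2 X3 = -1)" (is ?lower)
    if "prob_space N" and U: "distributed N lborel U (indicator {0..1})"
      and V: "distributed N lborel V (indicator {0..1})"
      and indep: "prob_space.indep_var N borel U borel V"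
    for N :: "'b measure" and U V :: "'b \<Rightarrow> real"
  proof -
    interpret N: prob_space N by fact
    \<comment> \<open>\<open>V\<close> is the coin of the reflection lemma. \<open>r id\<close> is
      the second coordinate of both couplings. \<open>g\<close> folds \<open>u\<close> to the larger
      and \<open>h\<close> to the smaller of \<open>u\<close> and \<open>1 - u\<close>;
      \<open>r g\<close> and \<open>r h\<close> are the third coordinates for the upper and the
      lower bound.\<close>
    define r where "r g \<omega> = (if V \<omega> > 1/2 then g (U \<omega>) else 1 - g (U \<omega>))"
      for g :: "real \<Rightarrow> real" and \<omega>
    define g where "g u = (if u > 1/2 then u else 1 - u)" for u :: real
    define h where "h u = (if u > 1/2 then 1 - u else u)" for u :: real
    have "distributed N lborel (r id) (indicator {0..1})"
      unfolding r_def by (rule N.uniform_reflection[OF U V indep]) auto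
    moreover have "distributed N lborel (r g) (indicator {0..1})"
      unfolding r_def g_def by (rule N.uniform_reflection[OF U V indep]) auto
    moreover have "distributed N lborel (r h) (indicator {0..1})"
      unfolding r_def h_def by (rule N.uniform_reflection[OF U V indep]) auto
    moreover have "r id \<omega> - 1/2 = (if V \<omega> > 1/2 then U \<omega> - 1/2 else - (U \<omega> - 1/2))"
      "r g \<omega> - 1/2 = (if V \<omega> > 1/2 then \<bar>U \<omega> - 1/2\<bar> else - \<bar>U \<omega> - 1/2\<bar>)"
      "r h \<omega> - 1/2 = (if V \<omega> > 1/2 then - \<bar>U \<omega> - 1/2\<bar> else \<bar>U \<omega> - 1/2\<bar>)" for \<omega>
      by (auto simp: r_def g_def h_def abs_if)
    \<comment> \<open>The sign chosen by the coin occurs in two factors and cancels, and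
      \<open>U \<omega> - 1/2\<close> occurs squared, so only the fixed sign from \<open>g\<close>
      or \<open>h\<close> survives.\<close>
    then have "(U \<omega> - 1/2) * (r id \<omega> - 1/2) * (r g \<omega> - 1/2) = 1 * \<bar>U \<omega> - 1/2\<bar>^3"
      "(U \<omega> - 1/2) * (r id \<omega> - 1/2) * (r h \<omega> - 1/2) = -1 * \<bar>U \<omega> - 1/2\<bar>^3" for \<omega>
      by (simp_all add: power3_eq_cube del: minus_diff_eq)
    ultimately have *: "has_df N (\<lambda>\<omega>. quantile (F 1) (U \<omega>)) (F 1)"
      "has_df N (\<lambda>\<omega>. quantile (F 2) (r id \<omega>)) (F 2)"
      "has_df N (\<lambda>\<omega>. quantile (F 3) (r g \<omega>)) (F 3)"
      "has_df N (\<lambda>\<omega>. quantile (F 3) (r h \<omega>)) (F 3)"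
      "rank_coskewness N (\<lambda>\<omega>. quantile (F 1) (U \<omega>)) (\<lambda>\<omega>. quantile (F 2) (r id \<omega>))
        (\<lambda>\<omega>. quantile (F 3) (r g \<omega>)) = 1"
      "rank_coskewness N (\<lambda>\<omega>. quantile (F 1) (U \<omega>)) (\<lambda>\<omega>. quantile (F 2) (r id \<omega>))
        (\<lambda>\<omega>. quantile (F 3) (r h \<omega>)) = -1"
      using U F by (auto intro!: N.has_df_quantile_uniform N.rank_coskewness_quantile_extremal)
    define I where "I = (indicator {\<omega>. U \<omega> > 1/2} :: 'b \<Rightarrow> real)"
    define J where "J = (indicator {\<omega>. V \<omega> > 1/2} :: 'b \<Rightarrow> real)"
    \<comment> \<open>Exactly one of the four indicator products is 1. The strict inequalities in
      \<open>r\<close>, \<open>g\<close> and \<open>h\<close> agree with those in \<open>I\<close>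
      and \<open>J\<close>, so the identities hold at every point, including the midpoint.\<close>
    have U23: "I \<omega> * J \<omega> * U \<omega> + I \<omega> * (1 - J \<omega>) * (1 - U \<omega>)
        + (1 - I \<omega>) * J \<omega> * U \<omega> + (1 - I \<omega>) * (1 - J \<omega>) * (1 - U \<omega>) = r id \<omega>"
      "I \<omega> * J \<omega> * U \<omega> + I \<omega> * (1 - J \<omega>) * (1 - U \<omega>)
        + (1 - I \<omega>) * J \<omega> * (1 - U \<omega>) + (1 - I \<omega>) * (1 - J \<omega>) * U \<omega> = r g \<omega>"
      "I \<omega> * J \<omega> * (1 - U \<omega>) + I \<omega> * (1 - J \<omega>) * U \<omega>
        + (1 - I \<omega>) * J \<omega> * U \<omega> + (1 - I \<omega>) * (1 - J \<omega>) * (1 - U \<omega>) = r h \<omega>" for \<omega>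
      by (auto simp: I_def J_def r_def g_def h_def indicator_def)
    show ?upper ?lower
      unfolding Let_def I_def[symmetric] J_def[symmetric] U23 using * by blast+
  qed

  show ?thesis
    using bounds invariance independent extremal by blast
qed

end
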